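(* For any $\varrho\in(0,1)$, the three classes $\mathcal{G}_\varrho$, $\mathcal{R}_\varrho$ and $\mathcal{SR}_\varrho$ are (pairwise) asymptotically equivalent. That is, for any two of these three classes and any function $h$ in one of them, there is a function $\widetilde h$ in the other one such that $\widetilde h(y)\sim h(y)$ as $y\searrow 0$.
   Context: For positive functions $h_1,h_2$ defined on a right neighborhood of $0$, $h_1(y)\sim h_2(y)$ as $y\searrow 0$ means $\lim_{y\searrow 0}h_1(y)/h_2(y)=1$. Two classes of functions are called asymptotically equivalent if for any function $h$ in one class there is a function $\widetilde h$ in the other class with $\widetilde h(y)\sim h(y)$ as $y\searrow 0$, and vice versa. For $\varrho\in\mathbb{R}$, $\mathcal{R}_\varrho$ is the family of functions $h:(0,y_0)\to(0,\infty)$ (with some $y_0>0$, possibly $\infty$, depending on $h$) that are regularly varying at $0$ of index $\varrho$: $h$ is measurable and $\lim_{y\searrow 0} h(ty)/h(y)=t^\varrho$ for all $t>0$. $\mathcal{SR}_\varrho$ is the family of those $h\in\mathcal{R}_\varrho$ that are $C^1$-smooth in a neighborhood of $0$, i.e. $h\in C^1(0,y_1]$ for some $y_1>0$. For $s\in(0,1)$, $\mathcal{G}_s$ is the family of functions $h:(0,\infty)\to(0,\infty)$ satisfying the following three conditions: (H1) $h$ is continuous and strictly increasing with $\lim_{x\searrow 0}h(x)=0$, $\lim_{x\searrow 0}h(x)/x=\infty$ and $\lim_{x\to\infty}h(x)=\infty$. (H2) For any $t>0$, $\lim_{x\searrow 0}h(tx)/h(x)=t^s$, where the convergence is uniform in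 $t$ on any compact subset of $(0,\infty)$. (H3) There exist constants $\tau\in(0,1)$, $m>0$, $x_0,t_0\in(0,1]$ such that $h(tx)/h(x)\ge m t^\tau$ for all $0<x\le x_0$ and $0<t\le t_0$. *)

theory Defs
  imports "HOL-Analysis.Analysis" "HOL-Library.Landau_Symbols"
begin

text \<open>
  A positive function on an interval \<open>(0, y0)\<close> is represented by a total function on the reals
  whose values outside the interval are irrelevant.
\<close>

text \<open>
  The domain is \<open>einterval 0 y0 = (0, y0)\<close>, where \<open>y0 = \<infinity>\<close> is allowed.
  ``Measurable'' means Lebesgue measurable, which is the larger class compared with Borel.
\<close>

definition regularly_varying :: "real \<Rightarrow> (real \<Rightarrow> real) set" where
  "regularly_varying \<rho> =
     {h. (\<exists>y0::ereal. 0 < y0 \<and>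
            (\<forall>y\<in>einterval 0 y0. 0 < h y) \<and>
            h \<in> borel_measurable (lebesgue_on (einterval 0 y0))) \<and>
         (\<forall>t>0. ((\<lambda>y. h (t * y) / h y) \<longlongrightarrow> t powr \<rho>) (at_right 0))}"

text \<open>
  Since \<open>y1\<close> may be shrunk, it need not be related to the domain bound \<open>y0\<close>, and it makes no
  difference whether the derivative at the endpoint \<open>y1\<close> is one-sided or two-sided.
\<close>

definition smoothly_regularly_varying :: "real \<Rightarrow> (real \<Rightarrow> real) set" where
  "smoothly_regularly_varying \<rho> =
     {h \<in> regularly_varying \<rho>. \<exists>y1>0. h C1_differentiable_on {0<..y1}}"

definition H1 :: "(real \<Rightarrow> real) \<Rightarrow> bool" where
  "H1 h \<longleftrightarrow>
     continuous_on {0<..} h \<and> strict_mono_on {0<..} h \<and>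
     (h \<longlongrightarrow> 0) (at_right 0) \<and>
     filterlim (\<lambda>x. h x / x) at_top (at_right 0) \<and>
     filterlim h at_top at_top"

definition H2 :: "real \<Rightarrow> (real \<Rightarrow> real) \<Rightarrow> bool" where
  "H2 s h \<longleftrightarrow>
     (\<forall>t>0. ((\<lambda>x. h (t * x) / h x) \<longlongrightarrow> t powr s) (at_right 0)) \<and>
     (\<forall>K. compact K \<and> K \<subseteq> {0<..} \<longrightarrow>
        uniform_limit K (\<lambda>x t. h (t * x) / h x) (\<lambda>t. t powr s) (at_right 0))"

definition H3 :: "(real \<Rightarrow> real) \<Rightarrow> bool" where
  "H3 h \<longleftrightarrow>
     (\<exists>\<tau> m x0 t0. 0 < \<tau> \<and> \<tau> < 1 \<and> 0 < m \<and> x0 \<in> {0<..1} \<and> t0 \<in> {0<..1} \<and>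
        (\<forall>x t. 0 < x \<and> x \<le> x0 \<and> 0 < t \<and> t \<le> t0 \<longrightarrow> h (t * x) / h x \<ge> m * t powr \<tau>))"

definition G_class :: "real \<Rightarrow> (real \<Rightarrow> real) set" where
  "G_class s = {h. (\<forall>x>0. 0 < h x) \<and> H1 h \<and> H2 s h \<and> H3 h}"

text \<open>
  For functions that are positive near \<open>0\<close>, the library relation \<open>\<sim>[at_right 0]\<close> says exactly
  that the quotient tends to \<open>1\<close>; its special treatment of \<open>0 / 0\<close> plays no role.
\<close>

definition asymptotically_equivalent_classes ::
    "(real \<Rightarrow> real) set \<Rightarrow> (real \<Rightarrow> real) set \<Rightarrow> bool" where
  "asymptotically_equivalent_classes A B \<longleftrightarrow>
     (\<forall>h\<in>A. \<exists>g\<in>B. g \<sim>[at_right 0] h) \<and>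
     (\<forall>h\<in>B. \<exists>g\<in>A. g \<sim>[at_right 0] h)"

end

theory Submission
  imports Defs
begin

text \<open>
  Both \<open>G_class \<rho>\<close> and \<open>smoothly_regularly_varying \<rho>\<close> are contained in \<open>regularly_varying \<rho>\<close>, so it is
  enough to find, for \<open>h\<close> regularly varying, an equivalent \<open>g\<close> lying in both. Write
  \<open>h y = exp (\<rho> * ln y + f y)\<close>; then \<open>f (t * y) - f y\<close> tends to \<open>0\<close>, uniformly for \<open>t\<close> in compact
  sets by measurability. Interpolate the values of \<open>f\<close> at \<open>exp (- k)\<close>, \<open>k \<ge> N\<close>, by a \<open>C\<^sup>1\<close> function \<open>F\<close> of
  \<open>x = - ln y\<close> that is constant for \<open>x \<le> N\<close>. Its derivative is bounded by the increments of the
  interpolated values: it tends to \<open>0\<close> and, for large \<open>N\<close>, is everywhere smaller than \<open>\<rho>\<close> and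
  \<open>1 - \<rho>\<close>. Uniform convergence makes \<open>F (- ln y) - f y\<close> tend to \<open>0\<close>, and the derivative bounds
  make \<open>g y = exp (\<rho> * ln y + F (- ln y))\<close> satisfy H1, H2 and H3 globally.
\<close>

section \<open>Uniform convergence of slowly oscillating functions\<close>

text \<open>By pointwise convergence, every \<open>t\<close> eventually satisfies the inequality at
  all later indices. The sets of \<open>t\<close> that are good from index \<open>n\<close> on
  therefore increase to the whole interval, and continuity of measure from below applies.\<close>

lemma scaled_slow_oscillation_measure:
  fixes f :: "real \<Rightarrow> real"
  assumes f: "f \<in> borel_measurable lebesgue"
    and slow: "\<And>t. t > 0 \<Longrightarrow> ((\<lambda>y. f (t * y) - f y) \<longlongrightarrow> 0) (at_right 0)"
    and y: "\<And>n. y n > 0" "y \<longlonglongrightarrow> 0" and "\<epsilon> > 0" and "0 < a" "a \<le> b" "\<delta> > 0"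
  shows "\<exists>N. \<forall>n\<ge>N. {t\<in>{a..b}. \<bar>f (t * y n) - f (y n)\<bar> < \<epsilon>} \<in> lmeasurable \<and>
                    measure lebesgue {t\<in>{a..b}. \<bar>f (t * y n) - f (y n)\<bar> < \<epsilon>} > b - a - \<delta>"
proof -
  define S where "S n = {t\<in>{a..b}. \<bar>f (t * y n) - f (y n)\<bar> < \<epsilon>}" for n
  define U where "U n = (\<Inter>m\<in>{n..}. S m)" for n
  have S_sets: "S n \<in> sets lebesgue" for n
  proof -
    \<comment> \<open>Dilation by the nonzero factor \<open>y n\<close> preserves Lebesgue
      measurability, whereas composition with an arbitrary continuous map need not.\<close>
    have m: "(\<lambda>t. f (t * y n)) \<in> borel_measurable lebesgue"
      using measurable_compose[OF lebesgue_measurable_scaling[of "y n"] f]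
      by (simp add: mult.commute)
    have "(\<lambda>t. \<bar>f (t * y n) - f (y n)\<bar>) -` {..<\<epsilon>} \<inter> space lebesgue \<in> sets lebesgue"
      by (rule measurable_sets[of _ lebesgue borel])
        (auto intro!: borel_measurable_abs borel_measurable_diff m)
    moreover have "S n = {a..b} \<inter> ((\<lambda>t. \<bar>f (t * y n) - f (y n)\<bar>) -` {..<\<epsilon>} \<inter> space lebesgue)"
      by (auto simp: S_def)
    ultimately show ?thesis by auto
  qed
  have S_sub: "S n \<subseteq> {a..b}" for n by (auto simp: S_def)
  have S_fm: "S n \<in> lmeasurable" for n
    by (rule fmeasurableI2[OF _ S_sub S_sets]) simp
  have U_sets: "U n \<in> sets lebesgue" for n
    unfolding U_def by (intro sets.countable_INT') (auto simp: S_sets)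
  have U_sub: "U n \<subseteq> S n" for n by (auto simp: U_def)
  have "incseq U" by (auto simp: incseq_def U_def)
  have Un: "(\<Union>n. U n) = {a..b}"
  proof
    show "(\<Union>n. U n) \<subseteq> {a..b}" using U_sub S_sub by blast
    show "{a..b} \<subseteq> (\<Union>n. U n)"
    proof
      fix t assume t: "t \<in> {a..b}"
      have "filterlim y (at_right 0) sequentially"
        using y by (simp add: tendsto_imp_filterlim_at_right)
      then have "(\<lambda>n. f (t * y n) - f (y n)) \<longlonglongrightarrow> 0"
        using filterlim_compose[OF slow[of t]] t \<open>0 < a\<close> by auto
      then have "\<forall>\<^sub>F n in sequentially. \<bar>f (t * y n) - f (y n)\<bar> < \<epsilon>"
        using \<open>\<epsilon> > 0\<close> by (auto dest!: tendstoD[where e=\<epsilon>])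
      then show "t \<in> (\<Union>n. U n)"
        using t by (auto simp: eventually_sequentially U_def S_def)
    qed
  qed
  have "(\<lambda>n. measure lebesgue (U n)) \<longlonglongrightarrow> measure lebesgue (\<Union>n. U n)"
  proof (rule Lim_measure_incseq)
    show "range U \<subseteq> sets lebesgue" using U_sets by auto
  qed (use \<open>incseq U\<close> \<open>a \<le> b\<close> in \<open>simp_all add: Un\<close>)
  then have "(\<lambda>n. measure lebesgue (U n)) \<longlonglongrightarrow> b - a"
    using \<open>a \<le> b\<close> by (simp add: Un)
  then have "\<forall>\<^sub>F n in sequentially. measure lebesgue (U n) > b - a - \<delta>"
    by (rule order_tendstoD) (use \<open>\<delta> > 0\<close> in simp)
  moreover have "measure lebesgue (U n) \<le> measure lebesgue (S n)" for n
    by (rule measure_mono_fmeasurable[OF U_sub U_sets S_fm])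
  ultimately show ?thesis
    using S_fm unfolding eventually_sequentially S_def[symmetric] by (meson less_le_trans)
qed

text \<open>
  If uniformity failed along \<open>y n\<close> and \<open>\<mu> n\<close>, the sets of \<open>t \<in> [1, 4]\<close> where \<open>f (t * y n)\<close> is close
  to \<open>f (y n)\<close>, and where \<open>f (t * (\<mu> n * y n))\<close> is close to \<open>f (\<mu> n * y n)\<close>, would eventually have
  almost full measure. The second one, dilated by \<open>\<mu> n \<le> 3\<close>, is then too large to avoid the first
  one inside \<open>[1, 4 * \<mu> n]\<close>.
\<close>

lemma uniform_convergence_slow_oscillation:
  fixes f :: "real \<Rightarrow> real"
  assumes f: "f \<in> borel_measurable lebesgue"
    and slow: "\<And>t. t > 0 \<Longrightarrow> ((\<lambda>y. f (t * y) - f y) \<longlongrightarrow> 0) (at_right 0)"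
    and "\<epsilon> > 0"
  shows "\<forall>\<^sub>F y in at_right 0. \<forall>\<mu>\<in>{1..3}. \<bar>f (\<mu> * y) - f y\<bar> < \<epsilon>"
proof (rule ccontr)
  assume "\<not> ?thesis"
  then have "\<exists>y. 0 < y \<and> y < \<delta> \<and> (\<exists>\<mu>\<in>{1..3}. \<bar>f (\<mu> * y) - f y\<bar> \<ge> \<epsilon>)" if "\<delta> > 0" for \<delta>
    using that unfolding eventually_at_right_field by (meson not_le)
  then have "\<exists>y \<mu>. 0 < y \<and> y < 1 / real (Suc n) \<and> \<mu> \<in> {1..3} \<and> \<bar>f (\<mu> * y) - f y\<bar> \<ge> \<epsilon>" for n
    by (metis of_nat_0_less_iff zero_less_Suc zero_less_divide_1_iff)
  then obtain y \<mu> where y: "\<And>n. 0 < y n" "\<And>n. y n < 1 / real (Suc n)"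
    and \<mu>: "\<And>n. \<mu> n \<in> {1..3}" and bad: "\<And>n. \<bar>f (\<mu> n * y n) - f (y n)\<bar> \<ge> \<epsilon>"
    by metis
  have y0: "y \<longlonglongrightarrow> 0"
    by (rule tendsto_sandwich[OF _ _ tendsto_const LIMSEQ_Suc[OF lim_1_over_n]])
      (use y in \<open>auto intro!: always_eventually less_imp_le\<close>)
  have \<mu>y: "\<mu> n * y n > 0" for n using \<mu>[of n] y(1)[of n] by simp
  \<comment> \<open>As the factors \<open>\<mu> n\<close> are bounded, the moving base points
    \<open>\<mu> n * y n\<close> also tend to 0, so the measure estimate applies to them as
    well.\<close>
  have \<mu>y0: "(\<lambda>n. \<mu> n * y n) \<longlonglongrightarrow> 0"
  proof (rule tendsto_sandwich[OF _ _ tendsto_const])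
    show "(\<lambda>n. 3 * y n) \<longlonglongrightarrow> 0" using tendsto_mult_right_zero[OF y0] by simp
    show "\<forall>\<^sub>F n in sequentially. \<mu> n * y n \<le> 3 * y n"
      using \<mu> y by (auto intro!: always_eventually mult_right_mono less_imp_le)
    show "\<forall>\<^sub>F n in sequentially. 0 \<le> \<mu> n * y n"
      using \<mu>y by (auto intro!: always_eventually less_imp_le)
  qed
  define U where "U n = {t\<in>{1..4}. \<bar>f (t * y n) - f (y n)\<bar> < \<epsilon> / 2}" for n
  define V where "V n = {t\<in>{1..4}. \<bar>f (t * (\<mu> n * y n)) - f (\<mu> n * y n)\<bar> < \<epsilon> / 2}" for n
  have "\<exists>N. \<forall>n\<ge>N. U n \<in> lmeasurable \<and> measure lebesgue (U n) > 4 - 1 - 1/8"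
    unfolding U_def
    by (rule scaled_slow_oscillation_measure[OF f _ _ y0])
      (erule slow | rule y(1) | use \<open>\<epsilon> > 0\<close> in simp)+
  then obtain N1 where N1: "\<And>n. n \<ge> N1 \<Longrightarrow> U n \<in> lmeasurable \<and> measure lebesgue (U n) > 4 - 1 - 1/8"
    by blast
  have "\<exists>N. \<forall>n\<ge>N. V n \<in> lmeasurable \<and> measure lebesgue (V n) > 4 - 1 - 1/8"
    unfolding V_def
    by (rule scaled_slow_oscillation_measure[OF f _ _ \<mu>y0])
      (erule slow | rule \<mu>y | use \<open>\<epsilon> > 0\<close> in simp)+
  then obtain N2 where N2: "\<And>n. n \<ge> N2 \<Longrightarrow> V n \<in> lmeasurable \<and> measure lebesgue (V n) > 4 - 1 - 1/8"
    by blast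
  define n where "n = max N1 N2"
  define W where "W = (\<lambda>t. \<mu> n *\<^sub>R t + 0) ` V n"
  have \<mu>n: "1 \<le> \<mu> n" "\<mu> n \<le> 3" using \<mu>[of n] by auto
  have Un: "U n \<in> lmeasurable" "measure lebesgue (U n) > 23/8"
    and Vn: "V n \<in> lmeasurable" "measure lebesgue (V n) > 23/8"
    using N1[of n] N2[of n] by (simp_all add: n_def)
  have "measure lebesgue W = \<mu> n * measure lebesgue (V n)"
    unfolding W_def using measure_lebesgue_affine[of "\<mu> n" 0 "V n"] \<mu>n by simp
  moreover have "\<mu> n * (23/8) \<le> \<mu> n * measure lebesgue (V n)"
    using \<mu>n Vn(2) by (intro mult_left_mono) auto
  ultimately have Wm: "measure lebesgue W \<ge> \<mu> n * (23/8)" by simp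
  \<comment> \<open>Measurability of the dilated set comes from writing it as a preimage under the
    inverse dilation.\<close>
  have W_eq: "W = (*\<^sub>R) (1 / \<mu> n) -` V n \<inter> space lebesgue"
  proof (rule set_eqI)
    fix x
    have "x \<in> W \<longleftrightarrow> (\<exists>t\<in>V n. t = x / \<mu> n)" using \<mu>n unfolding W_def by (force simp: field_simps)
    then show "x \<in> W \<longleftrightarrow> x \<in> (*\<^sub>R) (1 / \<mu> n) -` V n \<inter> space lebesgue" by simp
  qed
  have W_sets: "W \<in> sets lebesgue"
    unfolding W_eq by (rule measurable_sets[OF lebesgue_measurable_scaling]) (use Vn in auto)
  have W_sub: "W \<subseteq> {1..4 * \<mu> n}"
  proof
    fix x assume "x \<in> W"
    then obtain t where t: "x = \<mu> n * t" "1 \<le> t" "t \<le> 4" by (auto simp: W_def V_def)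
    have "1 * 1 \<le> \<mu> n * t" using t \<mu>n by (intro mult_mono) auto
    moreover have "\<mu> n * t \<le> \<mu> n * 4" using t \<mu>n by (intro mult_left_mono) auto
    ultimately show "x \<in> {1..4 * \<mu> n}" using t by auto
  qed
  have W_fm: "W \<in> lmeasurable"
    by (rule fmeasurableI2[OF _ W_sub W_sets]) simp
  have U_sub: "U n \<subseteq> {1..4 * \<mu> n}" using \<mu>n by (auto simp: U_def)
  \<comment> \<open>Disjoint sets inside \<open>{1..4 * \<mu> n}\<close> would give 23/8 * (1 +
    \<mu>) < 4 * \<mu> - 1, that is \<mu> > 31/9, which \<mu> \<le> 3 excludes. The loss 1/8 chosen
    above is small enough for this.\<close>
  have "U n \<inter> W \<noteq> {}"
  proof
    assume "U n \<inter> W = {}"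
    then have "measure lebesgue (U n \<union> W) = measure lebesgue (U n) + measure lebesgue W"
      using Un(1) W_fm by (simp add: measure_Un2 fmeasurableD Diff_triv Int_commute)
    moreover have "measure lebesgue (U n \<union> W) \<le> measure lebesgue {1..4 * \<mu> n}"
      using U_sub W_sub Un(1) W_sets by (intro measure_mono_fmeasurable) auto
    ultimately show False using Un Wm \<mu>n by simp
  qed
  \<comment> \<open>At the common point, \<open>f (v * (\<mu> n * y n))\<close> is within
    \<epsilon>/2 of both \<open>f (y n)\<close> and \<open>f (\<mu> n * y n)\<close>, so these two
    differ by less than \<epsilon>.\<close>
  then obtain v where "\<mu> n * v \<in> U n" "v \<in> V n" by (auto simp: W_def)
  then have "\<bar>f (\<mu> n * v * y n) - f (y n)\<bar> < \<epsilon> / 2"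
    and v: "\<bar>f (v * (\<mu> n * y n)) - f (\<mu> n * y n)\<bar> < \<epsilon> / 2"
    by (auto simp: U_def V_def)
  moreover have "\<mu> n * v * y n = v * (\<mu> n * y n)" by simp
  ultimately have "\<bar>f (v * (\<mu> n * y n)) - f (y n)\<bar> < \<epsilon> / 2" by metis
  with v bad[of n] show False by linarith
qed

section \<open>Interpolation of a sequence by a continuously differentiable function\<close>

lemma has_real_derivative_pos_part_square:
  fixes x :: real
  shows "((\<lambda>u. (max 0 u)\<^sup>2) has_real_derivative 2 * max 0 x) (at x)"
proof -
  consider "x < 0" | "x = 0" | "x > 0" by linarith
  then show ?thesis
  proof cases
    case 1
    have "((\<lambda>u. 0) has_real_derivative 2 * max 0 x) (at x)" using 1 by simp
    then show ?thesis
      by (rule has_field_derivative_transform_within_open[where S="{..<0}"]) (use 1 in auto)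
  next
    case 2
    have "((\<lambda>h::real. (max 0 h)\<^sup>2 / h) \<longlongrightarrow> 0) (at 0)"
    proof (rule Lim_null_comparison)
      show "\<forall>\<^sub>F h::real in at 0. norm ((max 0 h)\<^sup>2 / h) \<le> \<bar>h\<bar>"
        by (auto intro!: always_eventually simp: max_def power2_eq_square)
      show "((\<lambda>h::real. \<bar>h\<bar>) \<longlongrightarrow> 0) (at 0)"
        by (rule tendsto_rabs_zero) simp
    qed
    then show ?thesis using 2 by (simp add: DERIV_def)
  next
    case 3
    have "((\<lambda>u. u\<^sup>2) has_real_derivative 2 * max 0 x) (at x)"
      using 3 by (auto intro!: derivative_eq_intros)
    then show ?thesis
      by (rule has_field_derivative_transform_within_open[where S="{0<..}"]) (use 3 in auto)
  qed
qed

text \<open>The quadratic spline that rises from 0 to 1 on [0, 1]: it is 2u^2 up to 1/2 and 1 - 2(1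
  - u)^2 from there to 1. Writing it with truncated squares lets one derivative formula cover all
  the pieces.\<close>

definition smoothstep :: "real \<Rightarrow> real" where
  "smoothstep u = 2 * (max 0 u)\<^sup>2 - 4 * (max 0 (u - 1/2))\<^sup>2 + 2 * (max 0 (u - 1))\<^sup>2"

text \<open>The tent supported on [0, 1] with peak 2 at 1/2; this peak is the factor 2 in the
  derivative bound of the interpolation.\<close>

definition smoothstep' :: "real \<Rightarrow> real" where
  "smoothstep' u = 4 * max 0 u - 8 * max 0 (u - 1/2) + 4 * max 0 (u - 1)"

lemma smoothstep_deriv: "(smoothstep has_real_derivative smoothstep' x) (at x)"
proof -
  have shift: "((\<lambda>u. (max 0 (u - c))\<^sup>2) has_real_derivative 2 * max 0 (x - c)) (at x)" for c
    using DERIV_shift[of "\<lambda>u. (max 0 u)\<^sup>2" "2 * max 0 (x - c)" x "- c"]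
      has_real_derivative_pos_part_square[of "x - c"] by simp
  show ?thesis
    unfolding smoothstep_def[abs_def] smoothstep'_def
    using DERIV_add[OF DERIV_diff[OF DERIV_cmult[OF shift[of 0], of 2]
        DERIV_cmult[OF shift[of "1/2"], of 4]] DERIV_cmult[OF shift[of 1], of 2]]
    by simp
qed

lemma smoothstep_eq_0: "u \<le> 0 \<Longrightarrow> smoothstep u = 0" "u \<le> 0 \<Longrightarrow> smoothstep' u = 0"
  by (auto simp: smoothstep_def smoothstep'_def max_def)

lemma smoothstep_eq_1: "u \<ge> 1 \<Longrightarrow> smoothstep u = 1" "u \<ge> 1 \<Longrightarrow> smoothstep' u = 0"
  by (auto simp: smoothstep_def smoothstep'_def max_def power2_eq_square algebra_simps)

lemma smoothstep'_bounds: "0 \<le> smoothstep' u" "smoothstep' u \<le> 2"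
  by (auto simp: smoothstep'_def max_def)

lemma smoothstep_bounds: "0 \<le> smoothstep u" "smoothstep u \<le> 1"
proof -
  have mono: "smoothstep x \<le> smoothstep y" if "x \<le> y" for x y
    by (rule DERIV_nonneg_imp_nondecreasing[OF that]) (use smoothstep_deriv smoothstep'_bounds in blast)
  show "0 \<le> smoothstep u" using mono[of "min u 0" u] by (simp add: smoothstep_eq_0)
  show "smoothstep u \<le> 1" using mono[of u "max u 1"] by (simp add: smoothstep_eq_1)
qed

text \<open>Each increment of the sequence is spread over a unit cell by a shifted
  \<open>smoothstep\<close>. Inside the cell from \<open>n\<close> to \<open>n + 1\<close> the
  earlier steps are complete and the later ones have not begun, so only one increment
  matters.\<close>

lemma C1_interpolation:
  fixes a :: "nat \<Rightarrow> real"
  obtains F F' where "\<And>x. (F has_real_derivative F' x) (at x)" "continuous_on UNIV F'"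
    "\<And>x. x \<le> 0 \<Longrightarrow> F' x = 0"
    "\<And>n x. real n \<le> x \<Longrightarrow> x \<le> real n + 1 \<Longrightarrow> \<bar>F x - a n\<bar> \<le> \<bar>a (Suc n) - a n\<bar>"
    "\<And>n x. real n \<le> x \<Longrightarrow> x \<le> real n + 1 \<Longrightarrow> \<bar>F' x\<bar> \<le> 2 * \<bar>a (Suc n) - a n\<bar>"
proof -
  define d where "d n = a (Suc n) - a n" for n
  define P where "P N x = a 0 + (\<Sum>k<N. d k * smoothstep (x - real k))" for N x
  define P' where "P' N x = (\<Sum>k<N. d k * smoothstep' (x - real k))" for N x
  \<comment> \<open>This cutoff turns the infinite sum into a finite one: all later summands vanish
    at \<open>x\<close>. For negative \<open>x\<close>, \<open>nat\<close> gives 0 and leaves the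
    constant \<open>a 0\<close>.\<close>
  define F where "F x = P (nat \<lceil>x\<rceil>) x" for x
  define F' where "F' x = P' (nat \<lceil>x\<rceil>) x" for x
  have stable: "P M x = P N x" "P' M x = P' N x" if "x \<le> real N" "N \<le> M" for x M N
  proof -
    have "(\<Sum>k<M. d k * smoothstep (x - real k)) = (\<Sum>k<N. d k * smoothstep (x - real k))"
      by (rule sum.mono_neutral_right) (use that in \<open>auto simp: smoothstep_eq_0\<close>)
    then show "P M x = P N x" by (simp add: P_def)
    show "P' M x = P' N x" unfolding P'_def
      by (rule sum.mono_neutral_right) (use that in \<open>auto simp: smoothstep_eq_0\<close>)
  qed
  have FP: "F x = P N x" "F' x = P' N x" if "x \<le> real N" for x N
  proof -
    have "nat \<lceil>x\<rceil> \<le> N" "x \<le> real (nat \<lceil>x\<rceil>)" using that by linarith+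
    then show "F x = P N x" "F' x = P' N x" unfolding F_def F'_def
      by (simp_all add: stable[of x "nat \<lceil>x\<rceil>" N])
  qed
  have P_deriv: "(P N has_real_derivative P' N x) (at x)" for N x
    unfolding P_def[abs_def] P'_def
    by (auto intro!: derivative_eq_intros DERIV_chain2[OF smoothstep_deriv] simp: mult.commute)
  have P'_cont: "continuous_on UNIV (P' N)" for N
    unfolding P'_def[abs_def] smoothstep'_def by (intro continuous_intros)
  have piece: "F x = a n + d n * smoothstep (x - n)" "F' x = d n * smoothstep' (x - n)"
    if "real n \<le> x" "x \<le> real n + 1" for n x
  proof -
    \<comment> \<open>Completed steps contribute their full increments, and these telescope to
      \<open>a n\<close>.\<close>
    have "(\<Sum>k<n. d k * smoothstep (x - real k)) = (\<Sum>k<n. d k)"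
      by (rule sum.cong) (use that in \<open>auto simp: smoothstep_eq_1\<close>)
    also have "\<dots> = a n - a 0" unfolding d_def by (rule sum_lessThan_telescope)
    finally show "F x = a n + d n * smoothstep (x - n)"
      using FP(1)[of x "Suc n"] that by (simp add: P_def)
    have "(\<Sum>k<n. d k * smoothstep' (x - real k)) = 0"
      by (rule sum.neutral) (use that in \<open>auto simp: smoothstep_eq_1\<close>)
    then show "F' x = d n * smoothstep' (x - n)"
      using FP(2)[of x "Suc n"] that by (simp add: P'_def)
  qed
  show thesis
  proof
    fix x
    obtain N where N: "x < real N" using reals_Archimedean2 by blast
    show "(F has_real_derivative F' x) (at x)"
      \<comment> \<open>The cutoff depends on \<open>x\<close>, but on the open ray below
        \<open>N\<close> the function is the single finite sum \<open>P N\<close>, whose derivative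
        it inherits.\<close>
      unfolding FP(2)[OF less_imp_le[OF N]]
      by (rule has_field_derivative_transform_within_open[OF P_deriv, of "{..<real N}"])
        (use N in \<open>auto simp: FP[of _ N]\<close>)
    show "F' x = 0" if "x \<le> 0" using FP(2)[of x 0] that by (simp add: P'_def)
  next
    have "isCont F' x" for x
    proof -
      obtain N where N: "x < real N" using reals_Archimedean2 by blast
      have "continuous_on {..<real N} F'"
        using continuous_on_subset[OF P'_cont[of N], of "{..<real N}"]
        by (subst continuous_on_cong[OF refl, of _ _ "P' N"]) (auto simp: FP[of _ N])
      then show ?thesis using N by (simp add: continuous_on_eq_continuous_at)
    qed
    then show "continuous_on UNIV F'" by (simp add: continuous_on_eq_continuous_at)
  next
    fix n x assume nx: "real n \<le> x" "x \<le> real n + 1"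
    show "\<bar>F x - a n\<bar> \<le> \<bar>a (Suc n) - a n\<bar>"
      using smoothstep_bounds[of "x - n"] piece(1)[OF nx] 
      by (simp add: abs_mult d_def[symmetric] mult_left_le)
    show "\<bar>F' x\<bar> \<le> 2 * \<bar>a (Suc n) - a n\<bar>"
      using smoothstep'_bounds[of "x - n"] piece(2)[OF nx]
        mult_left_mono[of "smoothstep' (x - n)" 2 "\<bar>d n\<bar>"]
      by (simp add: abs_mult d_def[symmetric] mult.commute)
  qed
qed

section \<open>Exponentials of perturbed logarithms\<close>

text \<open>\<open>F\<close> is a function of -ln y. The bound \<kappa> < \<rho> yields monotonicity
  and the limits of \<open>g\<close>; \<kappa> < 1 - \<rho> yields the growth of
  \<open>g y / y\<close> and an exponent below 1 in \<open>H3\<close>; the limit of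
  \<open>F'\<close> yields \<open>H2\<close>.\<close>

locale log_perturbation =
  fixes \<rho> \<kappa> :: real and F F' :: "real \<Rightarrow> real"
  assumes \<rho>: "0 < \<rho>" "\<rho> < 1"
    and \<kappa>: "0 < \<kappa>" "\<kappa> < \<rho>" "\<kappa> < 1 - \<rho>"
    and deriv: "\<And>x. (F has_real_derivative F' x) (at x)"
    and cont: "continuous_on UNIV F'"
    and bound: "\<And>x. \<bar>F' x\<bar> \<le> \<kappa>"
    and lim: "(F' \<longlongrightarrow> 0) at_top"
begin

definition g :: "real \<Rightarrow> real" where "g y = exp (\<rho> * ln y + F (- ln y))"

lemma g_pos: "g y > 0" by (simp add: g_def)

text \<open>The mean value inequality with a local constant: it serves both with the global bound
  \<kappa> and with arbitrarily small bounds far out, where \<open>F'\<close> is small.\<close>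

lemma F_diff_le:
  assumes "\<And>x. x \<in> {min u v..max u v} \<Longrightarrow> \<bar>F' x\<bar> \<le> c"
  shows "\<bar>F u - F v\<bar> \<le> c * \<bar>u - v\<bar>"
  using field_differentiable_bound[of "{min u v..max u v}" F F' c u v] assms deriv
  by (auto simp: has_field_derivative_at_within)

lemma F_lipschitz: "\<bar>F u - F v\<bar> \<le> \<kappa> * \<bar>u - v\<bar>"
  by (rule F_diff_le) (rule bound)

lemma g_deriv:
  assumes "y > 0"
  shows "(g has_real_derivative g y * (\<rho> / y - F' (- ln y) / y)) (at y)"
proof -
  have "((\<lambda>y. F (- ln y)) has_real_derivative F' (- ln y) * (- (1 / y))) (at y)"
    by (rule DERIV_chain2[OF deriv]) (use assms in \<open>auto intro!: derivative_eq_intros\<close>)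
  then show ?thesis unfolding g_def[abs_def]
    using assms by (auto intro!: derivative_eq_intros simp: field_simps)
qed

lemma g_continuous: "continuous_on {0<..} g"
  by (rule DERIV_continuous_on[OF has_field_derivative_at_within[OF g_deriv]]) simp

lemma g_C1: "g C1_differentiable_on {0<..}"
  unfolding C1_differentiable_on_def
proof (intro exI conjI ballI)
  show "(g has_vector_derivative g y * (\<rho> / y - F' (- ln y) / y)) (at y)" if "y \<in> {0<..}" for y
    using g_deriv[of y] that by (simp add: has_real_derivative_iff_has_vector_derivative)
  have "continuous_on {0<..} (\<lambda>y::real. F' (- ln y))"
    by (rule continuous_on_compose2[OF cont]) (auto intro!: continuous_intros)
  then show "continuous_on {0<..} (\<lambda>y. g y * (\<rho> / y - F' (- ln y) / y))"
    by (intro continuous_intros g_continuous) auto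
qed

text \<open>The deviation from the pure power is isolated in an increment of \<open>F\<close> over
  an interval of length |ln t|.\<close>

lemma g_ratio:
  assumes "t > 0" "x > 0"
  shows "g (t * x) / g x = t powr \<rho> * exp (F (- ln x - ln t) - F (- ln x))"
proof -
  have "F (- ln (t * x)) = F (- ln x - ln t)"
    using assms by (intro arg_cong[of _ _ F]) (simp add: ln_mult)
  moreover have "ln (t * x) = ln t + ln x" using assms by (simp add: ln_mult)
  ultimately show ?thesis
    using assms by (simp add: g_def powr_def exp_add exp_diff distrib_left del: minus_add_distrib)
qed

text \<open>The linear term in ln y has slope \<rho>, which exceeds the Lipschitz constant \<kappa>
  of the perturbation.\<close>

lemma g_strict_mono: "strict_mono_on {0<..} g"
proof (rule strict_mono_onI)
  fix a b :: real assume ab: "a \<in> {0<..}" "b \<in> {0<..}" "a < b"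
  then have l: "ln a < ln b" by simp
  have "F (- ln a) - F (- ln b) \<le> \<kappa> * (ln b - ln a)"
    using F_lipschitz[of "- ln a" "- ln b"] l by simp
  also have "\<dots> < \<rho> * (ln b - ln a)" using l \<kappa> by (intro mult_strict_right_mono) auto
  finally show "g a < g b" by (simp add: g_def algebra_simps)
qed

lemma ln_right_tendsto: "filterlim (\<lambda>y::real. - ln y) at_top (at_right 0)"
  by (simp add: filterlim_uminus_at_top ln_at_0)

text \<open>Comparison of \<open>F (- ln y)\<close> with \<open>F 0\<close> bounds
  \<open>g y\<close> for y < 1 by a multiple of the power of \<open>y\<close> with positive exponent
  \<rho> - \<kappa>. The two limits that follow use the same comparison from below.\<close>

lemma g_tendsto_0: "(g \<longlongrightarrow> 0) (at_right 0)"
proof (rule tendsto_sandwich[OF _ _ tendsto_const])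
  show "\<forall>\<^sub>F y in at_right 0. 0 \<le> g y" using g_pos by (auto intro!: always_eventually less_imp_le)
  have "filterlim (\<lambda>y::real. (\<rho> - \<kappa>) * ln y) at_bot (at_right 0)"
    by (intro filterlim_tendsto_pos_mult_at_bot[OF tendsto_const] ln_at_0) (use \<kappa> in auto)
  then show "((\<lambda>y. exp (F 0) * exp ((\<rho> - \<kappa>) * ln y)) \<longlongrightarrow> 0) (at_right 0)"
    by (intro tendsto_mult_right_zero filterlim_compose[OF exp_at_bot])
  show "\<forall>\<^sub>F y in at_right 0. g y \<le> exp (F 0) * exp ((\<rho> - \<kappa>) * ln y)"
    using eventually_at_right_less[of "0::real"] eventually_at_right_real[OF zero_less_one]
  proof eventually_elim
    case (elim y)
    then have "ln y < 0" by simp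
    then show ?case using F_lipschitz[of "- ln y" 0] by (simp add: g_def algebra_simps flip: exp_add)
  qed
qed

lemma g_at_top: "filterlim g at_top at_top"
proof (rule filterlim_at_top_mono)
  have "filterlim (\<lambda>y. F 0 + (\<rho> - \<kappa>) * ln y) at_top at_top"
    by (intro filterlim_tendsto_add_at_top[OF tendsto_const]
        filterlim_tendsto_pos_mult_at_top[OF tendsto_const] ln_at_top) (use \<kappa> in auto)
  then show "filterlim (\<lambda>y. exp (F 0 + (\<rho> - \<kappa>) * ln y)) at_top at_top"
    by (rule filterlim_compose[OF exp_at_top])
  show "\<forall>\<^sub>F y in at_top. exp (F 0 + (\<rho> - \<kappa>) * ln y) \<le> g y"
    using eventually_gt_at_top[of 1]
  proof eventually_elim
    case (elim y)
    then have "ln y > 0" by simp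
    then show ?case using F_lipschitz[of "- ln y" 0] by (simp add: g_def algebra_simps)
  qed
qed

lemma g_div_at_top: "filterlim (\<lambda>y. g y / y) at_top (at_right 0)"
proof (rule filterlim_at_top_mono)
  have "filterlim (\<lambda>y. F 0 + (1 - \<rho> - \<kappa>) * - ln y) at_top (at_right 0)"
    by (intro filterlim_tendsto_add_at_top[OF tendsto_const]
        filterlim_tendsto_pos_mult_at_top[OF tendsto_const] ln_right_tendsto) (use \<kappa> in auto)
  then show "filterlim (\<lambda>y. exp (F 0 + (1 - \<rho> - \<kappa>) * - ln y)) at_top (at_right 0)"
    by (rule filterlim_compose[OF exp_at_top])
  show "\<forall>\<^sub>F y in at_right 0. exp (F 0 + (1 - \<rho> - \<kappa>) * - ln y) \<le> g y / y"
    using eventually_at_right_less[of "0::real"] eventually_at_right_real[OF zero_less_one]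
  proof eventually_elim
    case (elim y)
    then have l: "ln y < 0" by simp
    have "g y / y = exp (\<rho> * ln y + F (- ln y) - ln y)"
      using elim by (simp add: g_def exp_diff)
    then show ?case using F_lipschitz[of "- ln y" 0] l by (simp add: algebra_simps)
  qed
qed

text \<open>On a compact set |ln t| is bounded, so the increments of \<open>F\<close> run over
  intervals of bounded length. As x tends to 0 these move to infinity, where \<open>F'\<close> is
  small.\<close>

lemma g_uniform_limit:
  assumes "compact K" "K \<subseteq> {0<..}"
  shows "uniform_limit K (\<lambda>x t. g (t * x) / g x) (\<lambda>t. t powr \<rho>) (at_right 0)"
proof (rule uniform_limitI)
  fix e :: real assume "e > 0"
  have "compact ((\<lambda>t. t powr \<rho>) ` K)" "compact (ln ` K)"
    using assms by (auto intro!: compact_continuous_image continuous_intros)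
  then have "bounded ((\<lambda>t. t powr \<rho>) ` K)" "bounded (ln ` K)"
    by (auto intro: compact_imp_bounded)
  then obtain B A where B: "B > 0" "\<And>t. t \<in> K \<Longrightarrow> t powr \<rho> \<le> B"
    and A: "A > 0" "\<And>t. t \<in> K \<Longrightarrow> \<bar>ln t\<bar> \<le> A"
    unfolding bounded_pos by (auto simp: abs_le_iff)
  have "(exp \<longlongrightarrow> exp (0::real)) (at 0)" by (intro isContD) simp
  from LIM_D[OF this, of "e / B"]
  obtain s where s: "s > 0" "\<And>z::real. z \<noteq> 0 \<Longrightarrow> \<bar>z\<bar> < s \<Longrightarrow> \<bar>exp z - 1\<bar> < e / B"
    using \<open>e > 0\<close> B by auto
  have s': "\<bar>exp z - 1\<bar> < e / B" if "\<bar>z\<bar> < s" for z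
    using s(2)[of z] that \<open>e > 0\<close> B by (cases "z = 0") auto
  \<comment> \<open>An increment over length at most \<open>A\<close> is then at most s/2, strictly
    below \<open>s\<close>.\<close>
  have "\<forall>\<^sub>F x in at_top. \<bar>F' x\<bar> < s / (2 * A)"
    using tendstoD[OF lim, of "s / (2 * A)"] s A by auto
  then obtain X where X: "\<And>x. x \<ge> X \<Longrightarrow> \<bar>F' x\<bar> < s / (2 * A)"
    by (auto simp: eventually_at_top_linorder)
  \<comment> \<open>The margin \<open>A\<close> keeps the whole interval between
    \<open>- ln x - ln t\<close> and \<open>- ln x\<close> beyond \<open>X\<close>.\<close>
  have "\<forall>\<^sub>F x in at_right 0. - ln x \<ge> X + A"
    using ln_right_tendsto by (simp add: filterlim_at_top)
  then show "\<forall>\<^sub>F x in at_right 0. \<forall>t\<in>K. dist (g (t * x) / g x) (t powr \<rho>) < e"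
    using eventually_at_right_less[of "0::real"]
  proof eventually_elim
    case (elim x)
    show ?case
    proof
      fix t assume t: "t \<in> K"
      then have "t > 0" using assms by auto
      let ?z = "F (- ln x - ln t) - F (- ln x)"
      have "\<bar>?z\<bar> \<le> s / (2 * A) * \<bar>(- ln x - ln t) - (- ln x)\<bar>"
      proof (rule F_diff_le)
        fix u assume "u \<in> {min (- ln x - ln t) (- ln x)..max (- ln x - ln t) (- ln x)}"
        then have "u \<ge> X" using A(2)[OF t] A(1) elim by (auto simp: min_def split: if_splits)
        then show "\<bar>F' u\<bar> \<le> s / (2 * A)" using X by (simp add: less_imp_le)
      qed
      also have "\<dots> \<le> s / (2 * A) * A" using A t s by (intro mult_left_mono) auto
      also have "\<dots> < s" using A s by simp
      finally have z: "\<bar>?z\<bar> < s" .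
      have "dist (g (t * x) / g x) (t powr \<rho>) = t powr \<rho> * \<bar>exp ?z - 1\<bar>"
      proof -
        have "g (t * x) / g x - t powr \<rho> = t powr \<rho> * (exp ?z - 1)"
          using g_ratio[OF \<open>t > 0\<close>, of x] elim by (simp add: right_diff_distrib)
        then show ?thesis by (simp add: dist_real_def abs_mult)
      qed
      also have "\<dots> \<le> B * \<bar>exp ?z - 1\<bar>" using B t by (intro mult_right_mono) auto
      also have "\<dots> < B * (e / B)" using B s'[OF z] by (intro mult_strict_left_mono) auto
      also have "\<dots> = e" using B by simp
      finally show "dist (g (t * x) / g x) (t powr \<rho>) < e" .
    qed
  qed
qed

lemma g_pointwise_limit:
  assumes "t > 0"
  shows "((\<lambda>x. g (t * x) / g x) \<longlongrightarrow> t powr \<rho>) (at_right 0)"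
  using tendsto_uniform_limitI[OF g_uniform_limit[of "{t}"], of t] assms by simp

text \<open>The perturbation costs at most a factor \<open>t powr \<kappa>\<close>, so the exponent
  \<rho> + \<kappa> works. The Lipschitz bound is global, hence the remaining constants can all be
  1.\<close>

lemma g_H3: "H3 g"
  unfolding H3_def
proof (intro exI conjI allI impI)
  show "0 < \<rho> + \<kappa>" "\<rho> + \<kappa> < 1" "0 < (1::real)" "(1::real) \<in> {0<..1}" "(1::real) \<in> {0<..1}"
    using \<rho> \<kappa> by auto
  fix x t :: real assume "0 < x \<and> x \<le> 1 \<and> 0 < t \<and> t \<le> 1"
  then have xt: "0 < x" "0 < t" "t \<le> 1" by auto
  then have "ln t \<le> 0" by simp
  then have "\<kappa> * ln t \<le> F (- ln x - ln t) - F (- ln x)"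
    using F_lipschitz[of "- ln x - ln t" "- ln x"] by simp
  then have "t powr \<rho> * exp (\<kappa> * ln t) \<le> g (t * x) / g x"
    using xt by (simp add: g_ratio)
  then show "1 * t powr (\<rho> + \<kappa>) \<le> g (t * x) / g x"
    using xt by (simp add: powr_add powr_def[of t \<kappa>])
qed

lemma g_in_G_class: "g \<in> G_class \<rho>"
  unfolding G_class_def H1_def H2_def
  using g_pos g_continuous g_strict_mono g_tendsto_0 g_div_at_top g_at_top
    g_pointwise_limit g_uniform_limit g_H3 by auto

end

section \<open>From regular variation to slowly oscillating logarithms\<close>

lemma G_class_subset_regularly_varying: "G_class s \<subseteq> regularly_varying s"
proof
  fix h assume h: "h \<in> G_class s"
  have "einterval 0 \<infinity> = {0::real<..}" by (simp add: zero_ereal_def)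
  moreover have "h \<in> borel_measurable (lebesgue_on {0<..})"
    using h by (intro continuous_imp_measurable_on_sets_lebesgue) (auto simp: G_class_def H1_def)
  ultimately have "\<exists>y0::ereal. 0 < y0 \<and> (\<forall>y\<in>einterval 0 y0. 0 < h y) \<and>
      h \<in> borel_measurable (lebesgue_on (einterval 0 y0))"
    using h by (intro exI[of _ "\<infinity>"]) (simp add: G_class_def)
  then show "h \<in> regularly_varying s"
    using h by (simp add: regularly_varying_def G_class_def H2_def)
qed

lemma regularly_varying_log:
  assumes "h \<in> regularly_varying \<rho>"
  obtains f where "f \<in> borel_measurable lebesgue"
    "\<And>t. t > 0 \<Longrightarrow> ((\<lambda>y. f (t * y) - f y) \<longlongrightarrow> 0) (at_right 0)"
    "\<forall>\<^sub>F y in at_right 0. h y = exp (\<rho> * ln y + f y)"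
proof -
  obtain y0 :: ereal where y0: "0 < y0" "\<And>y. y \<in> einterval 0 y0 \<Longrightarrow> 0 < h y"
      "h \<in> borel_measurable (lebesgue_on (einterval 0 y0))"
    and lim: "\<And>t. t > 0 \<Longrightarrow> ((\<lambda>y. h (t * y) / h y) \<longlongrightarrow> t powr \<rho>) (at_right 0)"
    using assms unfolding regularly_varying_def by blast
  \<comment> \<open>A real bound is chosen because \<open>y0\<close> may be infinite.\<close>
  obtain c where c: "0 < ereal c" "ereal c < y0" using ereal_dense2[OF y0(1)] by blast
  then have "0 < c" by simp
  have sub: "{0<..<c} \<subseteq> einterval 0 y0"
    using c by (auto simp: einterval_def intro: less_trans[of _ "ereal c"])
  have pos: "0 < h y" if "0 < y" "y < c" for y using y0(2) sub that by auto
  \<comment> \<open>Outside the interval \<open>h\<close> need be neither positive nor measurable;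
    the value 0 there makes \<open>f\<close> measurable on the whole line.\<close>
  define f where "f y = (if y \<in> {0<..<c} then ln (h y) - \<rho> * ln y else 0)" for y
  have hm: "h \<in> borel_measurable (lebesgue_on {0<..<c})"
    by (rule measurable_restrict_mono[OF y0(3) sub])
  have "(\<lambda>y::real. \<rho> * ln y) \<in> borel_measurable (lebesgue_on {0<..<c})"
    by (intro continuous_imp_measurable_on_sets_lebesgue) (auto intro!: continuous_intros)
  then have "(\<lambda>y. ln (h y) - \<rho> * ln y) \<in> borel_measurable (lebesgue_on {0<..<c})"
    using hm by (intro borel_measurable_diff borel_measurable_ln)
  then have "f \<in> borel_measurable lebesgue"
    unfolding f_def[abs_def] by (rule borel_measurable_if_I) simp
  moreover have "((\<lambda>y. f (t * y) - f y) \<longlongrightarrow> 0) (at_right 0)" if "t > 0" for t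
  proof -
    have "((\<lambda>y. ln (h (t * y) / h y) - \<rho> * ln t) \<longlongrightarrow> ln (t powr \<rho>) - \<rho> * ln t) (at_right 0)"
      using that by (intro tendsto_intros lim) auto
    then have "((\<lambda>y. ln (h (t * y) / h y) - \<rho> * ln t) \<longlongrightarrow> 0) (at_right 0)"
      using that by (simp add: ln_powr)
    moreover have "\<forall>\<^sub>F y in at_right 0. ln (h (t * y) / h y) - \<rho> * ln t = f (t * y) - f y"
      using eventually_at_right_real[of 0 "min c (c / t)"]
    proof (rule eventually_mono)
      show "0 < min c (c / t)" using \<open>0 < c\<close> that by simp
      fix y assume "y \<in> {0<..<min c (c / t)}"
      then have y: "0 < y" "y < c" "0 < t * y" "t * y < c"
        using that by (auto simp: field_simps)
      have "ln (t * y) = ln t + ln y" using y that by (simp add: ln_mult)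
      then show "ln (h (t * y) / h y) - \<rho> * ln t = f (t * y) - f y"
        using y pos[of y] pos[of "t * y"] by (simp add: f_def ln_div algebra_simps)
    qed
    ultimately show ?thesis by (rule Lim_transform_eventually)
  qed
  moreover have "\<forall>\<^sub>F y in at_right 0. h y = exp (\<rho> * ln y + f y)"
    using eventually_at_right_real[OF \<open>0 < c\<close>] by eventually_elim (use pos in \<open>simp add: f_def\<close>)
  ultimately show thesis by (rule that)
qed

section \<open>Smooth approximation in the logarithmic variable\<close>

lemma slow_oscillation_C1_approximation:
  fixes f :: "real \<Rightarrow> real"
  assumes f: "f \<in> borel_measurable lebesgue"
    and slow: "\<And>t. t > 0 \<Longrightarrow> ((\<lambda>y. f (t * y) - f y) \<longlongrightarrow> 0) (at_right 0)"
    and "\<kappa> > 0"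
  obtains F F' where "\<And>x. (F has_real_derivative F' x) (at x)" "continuous_on UNIV F'"
    "\<And>x. \<bar>F' x\<bar> \<le> \<kappa>" "(F' \<longlongrightarrow> 0) at_top"
    "((\<lambda>y. F (- ln y) - f y) \<longlongrightarrow> 0) (at_right 0)"
proof -
  define b where "b k = f (exp (- real k))" for k
  \<comment> \<open>Each cell is compared with its end point \<open>exp (- real (Suc k))\<close>,
    the smallest value of \<open>y\<close> in it. All other points are multiples of it by factors
    between 1 and e, hence in \<open>{1..3}\<close>.\<close>
  have osc: "\<exists>X. \<forall>k x. X \<le> x \<longrightarrow> real k \<le> x \<longrightarrow> x \<le> real k + 1 \<longrightarrow>
      \<bar>f (exp (- x)) - b (Suc k)\<bar> < \<epsilon> \<and> \<bar>b (Suc k) - b k\<bar> < \<epsilon>" if "\<epsilon> > 0" for \<epsilon>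
  proof -
    obtain \<delta> where \<delta>: "\<delta> > 0"
      "\<And>y \<mu>. 0 < y \<Longrightarrow> y < \<delta> \<Longrightarrow> \<mu> \<in> {1..3} \<Longrightarrow> \<bar>f (\<mu> * y) - f y\<bar> < \<epsilon>"
      using uniform_convergence_slow_oscillation[OF f slow \<open>\<epsilon> > 0\<close>]
      unfolding eventually_at_right_field by blast
    show ?thesis
    \<comment> \<open>The summand 1 makes the base point strictly smaller than \<delta>.\<close>
    proof (intro exI[of _ "1 - ln \<delta>"] allI impI)
      fix k :: nat and x :: real assume x: "1 - ln \<delta> \<le> x" "real k \<le> x" "x \<le> real k + 1"
      define y where "y = exp (- real (Suc k))"
      have "y < exp (ln \<delta>)" unfolding y_def using x by (subst exp_less_cancel_iff) simp
      then have y: "0 < y" "y < \<delta>" using \<delta>(1) by (simp_all add: y_def)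
      have near: "\<bar>f (exp (- z)) - b (Suc k)\<bar> < \<epsilon>" if "real k \<le> z" "z \<le> real k + 1" for z
      proof -
        have "exp (real k + 1 - z) \<le> exp 1" using that by simp
        also have "exp 1 \<le> (3::real)" by (rule exp_le)
        finally have "exp (real k + 1 - z) \<in> {1..3}" using that by simp
        from \<delta>(2)[OF y this] show ?thesis
          by (simp add: y_def b_def flip: exp_add)
      qed
      show "\<bar>f (exp (- x)) - b (Suc k)\<bar> < \<epsilon> \<and> \<bar>b (Suc k) - b k\<bar> < \<epsilon>"
        using near[OF x(2,3)] near[of "real k"] by (simp add: b_def abs_minus_commute)
    qed
  qed
  \<comment> \<open>Half of \<kappa> compensates for the factor 2 in the derivative bound of the
    interpolation.\<close>
  obtain X where X: "\<And>k x. X \<le> x \<Longrightarrow> real k \<le> x \<Longrightarrow> x \<le> real k + 1 \<Longrightarrow> \<bar>b (Suc k) - b k\<bar> < \<kappa> / 2"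
    using osc[of "\<kappa> / 2"] \<open>\<kappa> > 0\<close> by auto
  define N where "N = nat \<lceil>X\<rceil>"
  have N: "X \<le> real N" unfolding N_def by linarith
  obtain F F' where F: "\<And>x. (F has_real_derivative F' x) (at x)" "continuous_on UNIV F'"
    "\<And>x. x \<le> 0 \<Longrightarrow> F' x = 0"
    "\<And>n x. real n \<le> x \<Longrightarrow> x \<le> real n + 1 \<Longrightarrow> \<bar>F x - b (n + N)\<bar> \<le> \<bar>b (Suc (n + N)) - b (n + N)\<bar>"
    "\<And>n x. real n \<le> x \<Longrightarrow> x \<le> real n + 1 \<Longrightarrow> \<bar>F' x\<bar> \<le> 2 * \<bar>b (Suc (n + N)) - b (n + N)\<bar>"
    \<comment> \<open>Dropping the first \<open>N\<close> samples discards the uncontrolled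
      increments; to the left of \<open>N\<close> the translated interpolant is constant.\<close>
    using C1_interpolation[of "\<lambda>n. b (n + N)"] by (metis add_Suc)
  have cell: "\<exists>k. real k \<le> x \<and> x \<le> real k + 1 \<and> \<bar>F (x - real N) - b k\<bar> \<le> \<bar>b (Suc k) - b k\<bar> \<and>
      \<bar>F' (x - real N)\<bar> \<le> 2 * \<bar>b (Suc k) - b k\<bar>" if "real N \<le> x" for x
  proof -
    define n where "n = nat \<lfloor>x - real N\<rfloor>"
    have "real n \<le> x - real N" "x - real N \<le> real n + 1" using that unfolding n_def by linarith+
    then show ?thesis using F(4,5)[of n "x - real N"] by (intro exI[of _ "n + N"]) auto
  qed
  show thesis
  proof (rule that[of "\<lambda>x. F (x - real N)" "\<lambda>x. F' (x - real N)"])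
    fix x :: real
    show "((\<lambda>x. F (x - real N)) has_real_derivative F' (x - real N)) (at x)"
      using DERIV_shift[of F "F' (x - real N)" x "- real N"] F(1)[of "x - real N"] by simp
    show "continuous_on UNIV (\<lambda>x. F' (x - real N))"
      by (rule continuous_on_compose2[OF F(2)]) (auto intro!: continuous_intros)
    show "\<bar>F' (x - real N)\<bar> \<le> \<kappa>"
    proof (cases "real N \<le> x")
      case True
      then obtain k where "real k \<le> x" "x \<le> real k + 1" "\<bar>F' (x - real N)\<bar> \<le> 2 * \<bar>b (Suc k) - b k\<bar>"
        using cell by blast
      then show ?thesis using X[of x k, OF order_trans[OF N True]] by simp
    next
      case False
      then show ?thesis using F(3)[of "x - real N"] \<open>\<kappa> > 0\<close> by simp
    qed
  next
    show "((\<lambda>x. F' (x - real N)) \<longlongrightarrow> 0) at_top"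
    proof (rule tendstoI)
      fix e :: real assume "e > 0"
      then obtain Y where Y: "\<And>k x. Y \<le> x \<Longrightarrow> real k \<le> x \<Longrightarrow> x \<le> real k + 1 \<Longrightarrow>
          \<bar>b (Suc k) - b k\<bar> < e / 2"
        using osc[of "e / 2"] by auto
      show "\<forall>\<^sub>F x in at_top. dist (F' (x - real N)) 0 < e"
        using eventually_ge_at_top[of "max Y N"]
      proof eventually_elim
        case (elim x)
        then obtain k where "real k \<le> x" "x \<le> real k + 1" "\<bar>F' (x - real N)\<bar> \<le> 2 * \<bar>b (Suc k) - b k\<bar>"
          using cell[of x] by auto
        then show ?case using Y[of x k] elim by simp
      qed
    qed
    show "((\<lambda>y. F (- ln y - real N) - f y) \<longlongrightarrow> 0) (at_right 0)"
    proof (rule tendstoI)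
      fix e :: real assume "e > 0"
      \<comment> \<open>The error passes through \<open>b k\<close> and \<open>b (Suc k)\<close>:
        three distances, each below e/3.\<close>
      then obtain Y where Y: "\<And>k x. Y \<le> x \<Longrightarrow> real k \<le> x \<Longrightarrow> x \<le> real k + 1 \<Longrightarrow>
          \<bar>f (exp (- x)) - b (Suc k)\<bar> < e / 3 \<and> \<bar>b (Suc k) - b k\<bar> < e / 3"
        using osc[of "e / 3"] by auto
      have "filterlim (\<lambda>y::real. - ln y) at_top (at_right 0)"
        by (simp add: filterlim_uminus_at_top ln_at_0)
      then have "\<forall>\<^sub>F y in at_right 0. max Y N \<le> - ln y"
        by (simp only: filterlim_at_top)
      then show "\<forall>\<^sub>F y in at_right 0. dist (F (- ln y - real N) - f y) 0 < e"
        using eventually_at_right_less[of "0::real"]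
      proof eventually_elim
        case (elim y)
        then obtain k where k: "real k \<le> - ln y" "- ln y \<le> real k + 1"
            "\<bar>F (- ln y - real N) - b k\<bar> \<le> \<bar>b (Suc k) - b k\<bar>"
          using cell[of "- ln y"] by auto
        have "Y \<le> - ln y" using elim by simp
        from Y[OF this k(1,2)] have "\<bar>f y - b (Suc k)\<bar> < e / 3" "\<bar>b (Suc k) - b k\<bar> < e / 3"
          using elim by simp_all
        with k(3) have "\<bar>F (- ln y - real N) - f y\<bar> < e" by linarith
        then show ?case by (simp add: dist_real_def)
      qed
    qed
  qed
qed

section \<open>Asymptotic equivalence of the three classes\<close>

lemma regularly_varying_smooth_representative:
  assumes \<rho>: "0 < \<rho>" "\<rho> < 1" and h: "h \<in> regularly_varying \<rho>"
  shows "\<exists>g\<in>G_class \<rho> \<inter> smoothly_regularly_varying \<rho>. g \<sim>[at_right 0] h"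
proof -
  obtain f where f: "f \<in> borel_measurable lebesgue"
    "\<And>t. t > 0 \<Longrightarrow> ((\<lambda>y. f (t * y) - f y) \<longlongrightarrow> 0) (at_right 0)"
    and hf: "\<forall>\<^sub>F y in at_right 0. h y = exp (\<rho> * ln y + f y)"
    using regularly_varying_log[OF h] by blast
  \<comment> \<open>Halving makes both inequalities required of \<kappa> strict.\<close>
  define \<kappa> where "\<kappa> = min \<rho> (1 - \<rho>) / 2"
  have \<kappa>: "0 < \<kappa>" "\<kappa> < \<rho>" "\<kappa> < 1 - \<rho>" using \<rho> by (auto simp: \<kappa>_def)
  obtain F F' where F: "\<And>x. (F has_real_derivative F' x) (at x)" "continuous_on UNIV F'"
    "\<And>x. \<bar>F' x\<bar> \<le> \<kappa>" "(F' \<longlongrightarrow> 0) at_top"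
    and Ff: "((\<lambda>y. F (- ln y) - f y) \<longlongrightarrow> 0) (at_right 0)"
    using slow_oscillation_C1_approximation[OF f \<kappa>(1)] by blast
  interpret log_perturbation \<rho> \<kappa> F F'
    by unfold_locales (use \<rho> \<kappa> F in auto)
  have "g C1_differentiable_on {0<..1}" by (rule C1_differentiable_on_subset[OF g_C1]) auto
  then have "g \<in> smoothly_regularly_varying \<rho>"
    using g_in_G_class G_class_subset_regularly_varying
    unfolding smoothly_regularly_varying_def by (auto intro!: exI[of _ 1])
  moreover have "g \<sim>[at_right 0] h"
  proof (rule asymp_equivI')
    \<comment> \<open>The powers of \<open>y\<close> cancel in the quotient, which leaves the
      exponential of the approximation error.\<close>
    have "((\<lambda>y. exp (F (- ln y) - f y)) \<longlongrightarrow> 1) (at_right 0)"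
      using tendsto_exp[OF Ff] by simp
    moreover have "\<forall>\<^sub>F y in at_right 0. exp (F (- ln y) - f y) = g y / h y"
      using hf by eventually_elim (simp add: g_def flip: exp_diff)
    ultimately show "((\<lambda>y. g y / h y) \<longlongrightarrow> 1) (at_right 0)"
      by (rule Lim_transform_eventually)
  qed
  ultimately show ?thesis using g_in_G_class by blast
qed

theorem theorem2p2:
  fixes \<rho> :: real
  assumes "0 < \<rho>" and "\<rho> < 1"
  shows "asymptotically_equivalent_classes (G_class \<rho>) (regularly_varying \<rho>)
       \<and> asymptotically_equivalent_classes (G_class \<rho>) (smoothly_regularly_varying \<rho>)
       \<and> asymptotically_equivalent_classes (regularly_varying \<rho>) (smoothly_regularly_varying \<rho>)"
proof -
  \<comment> \<open>By the inclusions every given function is regularly varying, so its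
    representative settles the directions into the two smaller classes; towards
    \<open>regularly_varying\<close> the function itself suffices.\<close>
  have "smoothly_regularly_varying \<rho> \<subseteq> regularly_varying \<rho>"
    by (auto simp: smoothly_regularly_varying_def)
  then show ?thesis
    unfolding asymptotically_equivalent_classes_def
    using regularly_varying_smooth_representative[OF assms] G_class_subset_regularly_varying[of \<rho>]
      asymp_equiv_refl by blast
qed

end
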